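(* Let $A|H$ and $B|K$ be conditional events ($H\neq\emptyset$, $K\neq\emptyset$) with $A|H\subseteq B|K$ in the sense of Goodman and Nguyen, i.e. $AH\subseteq BK$ and $B^cK\subseteq A^cH$. Let $P(A|H)=x$, $P(B|K)=y$ and let all the previsions involved form a coherent assessment. Then $$(A|H)\wedge(B|K)=A|H .$$
   Context: Events are identified with their indicators (value 1 if true, 0 if false); $\emptyset$ is the impossible event, $H^c$ the negation of $H$, juxtaposition denotes conjunction (product of indicators), and for events $E\subseteq F$ means $EF^c=\emptyset$. A finite random quantity is a real quantity with finitely many possible values (a finitely-valued real function of the possible outcomes). Equality of random quantities means that they take the same value in every possible outcome. For an event $H\neq\emptyset$ and a finite random quantity $X$ with assessed conditional prevision $\mathbb{P}(X|H)=\mu\in\mathbb{R}$, the conditional random quantity $X|H$ is the random quantity $X|H = XH+\mu H^c$. For an event $A$ with $P(A|H)=x$ one has $A|H=AH+xH^c$. Conjunction: given $P(A|H)=x$, $P(B|K)=y$, the conjunction is the conditional random quantity $(A|H)\wedge(B|K)=\min\{A|H,B|K\}\,|\,(H\vee K)$, where $A|H=AH+xH^c$ and $B|K=BK+yK^c$. Coherence: a real function $\mathbb{P}$ on a family $\mathcal{K}$ of finite conditional random quantities is coherent iff for all $n\ge1$, all $X_1|H_1,\dots,X_n|H_n\in\mathcal{K}$ and all real $s_1,\dots,s_n$, setting $\mu_i=\mathbb{P}(X_i|H_i)$ and $\mathcal{G}=\sum_{i=1}^n s_iH_i(X_i-\mu_i)$, the minimum and maximum of the values of $\mathcal{G}$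 over the outcomes where $H_1\vee\cdots\vee H_n$ is true satisfy $\min\mathcal{G}\le 0\le\max\mathcal{G}$. *)

theory Defs
  imports Complex_Main "HOL-Library.Indicator_Function"
begin

text \<open>
  Outcomes are the elements of an arbitrary type \<open>'w\<close>; events are sets of outcomes.
  A pair \<open>(X, H)\<close> stands for the object \<open>X|H\<close> to which a prevision is assigned, and an
  assessment \<open>P\<close> assigns to such pairs their conditional previsions. Only the values of \<open>P\<close>
  on the assessed family are meaningful.
\<close>

type_synonym 'w assessment = "('w \<Rightarrow> real) \<times> 'w set \<Rightarrow> real"

definition finite_rq :: "('w \<Rightarrow> real) \<Rightarrow> bool" where
  "finite_rq X \<longleftrightarrow> finite (range X)"

definition gain ::
  "'w assessment \<Rightarrow> nat \<Rightarrow> (nat \<Rightarrow> 'w \<Rightarrow> real) \<Rightarrow> (nat \<Rightarrow> 'w set) \<Rightarrow> (nat \<Rightarrow> real) \<Rightarrow> 'w \<Rightarrow> real"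
  where "gain P n X H s = (\<lambda>\<omega>. \<Sum>i=1..n. s i * indicator (H i) \<omega> * (X i \<omega> - P (X i, H i)))"

text \<open>
  The first conjunct ensures that the gain takes a finite nonempty set of values on
  \<open>H\<^sub>1 \<union> \<dots> \<union> H\<^sub>n\<close>, so that \<open>Min\<close> and \<open>Max\<close> are meaningful.
\<close>

definition coherent :: "'w assessment \<Rightarrow> (('w \<Rightarrow> real) \<times> 'w set) set \<Rightarrow> bool" where
  "coherent P \<K> \<longleftrightarrow>
     (\<forall>(X, H)\<in>\<K>. finite_rq X \<and> H \<noteq> {}) \<and>
     (\<forall>n\<ge>1. \<forall>X H s. (\<forall>i\<in>{1..n}. (X i, H i) \<in> \<K>) \<longrightarrow>
        Min (gain P n X H s ` (\<Union>i\<in>{1..n}. H i)) \<le> 0 \<and>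
        0 \<le> Max (gain P n X H s ` (\<Union>i\<in>{1..n}. H i)))"

definition cond_rq :: "'w assessment \<Rightarrow> ('w \<Rightarrow> real) \<Rightarrow> 'w set \<Rightarrow> 'w \<Rightarrow> real" where
  "cond_rq P X H = (\<lambda>\<omega>. X \<omega> * indicator H \<omega> + P (X, H) * indicator (- H) \<omega>)"

definition cond_event :: "'w assessment \<Rightarrow> 'w set \<Rightarrow> 'w set \<Rightarrow> 'w \<Rightarrow> real" where
  "cond_event P A H = cond_rq P (indicator A) H"

definition min_cond ::
  "'w assessment \<Rightarrow> 'w set \<Rightarrow> 'w set \<Rightarrow> 'w set \<Rightarrow> 'w set \<Rightarrow> 'w \<Rightarrow> real" where
  "min_cond P A H B K = (\<lambda>\<omega>. min (cond_event P A H \<omega>) (cond_event P B K \<omega>))"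

definition conjunction ::
  "'w assessment \<Rightarrow> 'w set \<Rightarrow> 'w set \<Rightarrow> 'w set \<Rightarrow> 'w set \<Rightarrow> 'w \<Rightarrow> real" where
  "conjunction P A H B K = cond_rq P (min_cond P A H B K) (H \<union> K)"

definition goodman_nguyen :: "'w set \<Rightarrow> 'w set \<Rightarrow> 'w set \<Rightarrow> 'w set \<Rightarrow> bool" where
  "goodman_nguyen A H B K \<longleftrightarrow> A \<inter> H \<subseteq> B \<inter> K \<and> (- B) \<inter> K \<subseteq> (- A) \<inter> H"

end

theory Submission
  imports Defs
begin

text \<open>
  Inside \<open>H \<union> K\<close> the Goodman-Nguyen inclusion leaves three cases. Where \<open>A H\<close> holds, so does
  \<open>B K\<close>, and both conditional events are worth 1. Where \<open>H\<close> holds and \<open>A\<close> fails, \<open>A|H\<close> is worth 0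
  while \<open>B|K\<close> is worth 0, 1 or \<open>y\<close>. Where \<open>K\<close> holds and \<open>H\<close> fails, \<open>B\<close> must hold, so \<open>B|K\<close> is
  worth 1 while \<open>A|H\<close> is worth \<open>x\<close>. Coherent previsions lie between the bounds of their quantity
  (lemma \<open>coherent_prevision_bounds\<close>), so \<open>0 \<le> y\<close> and \<open>x \<le> 1\<close>, and the minimum is \<open>A|H\<close>
  on all of \<open>H \<union> K\<close>.

  Outside \<open>H \<union> K\<close> the conjunction is worth its own prevision, while \<open>A|H\<close> is worth \<open>x\<close>; it
  remains to see that the two prices agree. Buying the conjunction and selling \<open>A|H\<close> yields a
  constant gain, the difference of the two prices, on \<open>H \<union> K\<close>; coherence forces a constant gain
  to vanish (lemma \<open>coherent_prevision_cond_rq\<close>).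
\<close>

text \<open>
  A unit bet on a single conditional quantity can neither surely win nor surely lose, so its price
  is caught between values that the quantity takes on the conditioning event.
\<close>

lemma coherent_prevision_bounds:
  assumes coh: "coherent P \<K>" and mem: "(X, H) \<in> \<K>"
    and bounds: "\<And>\<omega>. \<omega> \<in> H \<Longrightarrow> a \<le> X \<omega> \<and> X \<omega> \<le> b"
  shows "a \<le> P (X, H)" and "P (X, H) \<le> b"
proof -
  let ?g = "gain P 1 (\<lambda>_. X) (\<lambda>_. H) (\<lambda>_. 1)"
  from coh mem have fin: "finite (range X)" and ne: "H \<noteq> {}"
    by (auto simp: coherent_def finite_rq_def)
  have img: "?g ` H = (\<lambda>t. t - P (X, H)) ` X ` H"
    by (force simp: gain_def image_image)
  have "finite (X ` H)"
    using fin by (rule finite_subset[rotated]) auto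
  then have "finite (?g ` H)" unfolding img by (rule finite_imageI)
  moreover have "?g ` H \<noteq> {}" using ne by simp
  ultimately have "Min (?g ` H) \<in> ?g ` H" and "Max (?g ` H) \<in> ?g ` H"
    by (blast intro: Min_in Max_in)+
  moreover have "(\<Union>i\<in>{1..1::nat}. H) = H" by simp
  then have "Min (?g ` H) \<le> 0 \<and> 0 \<le> Max (?g ` H)"
    using coh mem unfolding coherent_def
    by (metis (no_types, lifting) order_refl)
  ultimately show "a \<le> P (X, H)" and "P (X, H) \<le> b"
    using bounds unfolding img by fastforce+
qed

text \<open>
  A conditional random quantity \<open>Y|H\<close> is worth its own price: when it is bought conditionally on a
  larger event \<open>L\<close>, the fair price is again \<open>P(Y|H)\<close>. Otherwise buying one and selling the other
  gains the difference of the prices for sure, since the bet on \<open>Y|H\<close> is called off exactly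
  where \<open>Y|H\<close> equals \<open>P(Y|H)\<close>.
\<close>

lemma coherent_prevision_cond_rq:
  assumes coh: "coherent P \<K>"
    and memY: "(Y, H) \<in> \<K>" and memX: "(X, L) \<in> \<K>" and sub: "H \<subseteq> L"
    and eq: "\<And>\<omega>. \<omega> \<in> L \<Longrightarrow> X \<omega> = cond_rq P Y H \<omega>"
  shows "P (X, L) = P (Y, H)"
proof -
  define Z where "Z i = (if i = 1 then X else Y)" for i :: nat
  define E where "E i = (if i = 1 then L else H)" for i :: nat
  define s where "s i = (if i = 1 then 1 else -1 :: real)" for i :: nat
  let ?c = "P (Y, H) - P (X, L)"
  have two: "{1..2::nat} = {1, 2}" by auto
  have un: "(\<Union>i\<in>{1..2::nat}. E i) = L"
    using sub by (auto simp: two E_def)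
  have "gain P 2 Z E s \<omega> = ?c" if "\<omega> \<in> L" for \<omega>
    using that eq[OF that]
    unfolding gain_def two
    by (cases "\<omega> \<in> H") (simp_all add: Z_def E_def s_def cond_rq_def)
  moreover have "L \<noteq> {}" using coh memX by (auto simp: coherent_def)
  ultimately have img: "gain P 2 Z E s ` L = {?c}" by auto
  have "\<forall>i\<in>{1..2}. (Z i, E i) \<in> \<K>"
    using memX memY by (auto simp: Z_def E_def)
  moreover have "(1::nat) \<le> 2" by simp
  ultimately have "Min (gain P 2 Z E s ` L) \<le> 0 \<and> 0 \<le> Max (gain P 2 Z E s ` L)"
    using coh unfolding coherent_def un[symmetric] by blast
  then show ?thesis by (simp add: img)
qed

theorem mainTheorem9:
  fixes A H B K :: "'w set" and P :: "'w assessment" and x y :: real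
  assumes "H \<noteq> {}" and "K \<noteq> {}"
    and "goodman_nguyen A H B K"
    and "P (indicator A, H) = x" and "P (indicator B, K) = y"
    and "coherent P {(indicator A, H), (indicator B, K), (min_cond P A H B K, H \<union> K)}"
  shows "conjunction P A H B K = cond_event P A H"
proof -
  note coh = assms(6)
  have gn: "A \<inter> H \<subseteq> B \<inter> K" "- B \<inter> K \<subseteq> - A \<inter> H"
    using assms(3) by (auto simp: goodman_nguyen_def)
  have x1: "P (indicator A, H) \<le> 1"
    by (rule coherent_prevision_bounds(2)[OF coh, where a = 0]) (auto simp: indicator_def)
  have y0: "0 \<le> P (indicator B, K)"
    by (rule coherent_prevision_bounds(1)[OF coh, where b = 1]) (auto simp: indicator_def)
  have min_eq: "min_cond P A H B K \<omega> = cond_event P A H \<omega>" if "\<omega> \<in> H \<union> K" for \<omega>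
    using that gn x1 y0
    by (auto simp: min_cond_def cond_event_def cond_rq_def indicator_def)
  have "P (min_cond P A H B K, H \<union> K) = P (indicator A, H)"
    using min_eq
    by (intro coherent_prevision_cond_rq[OF coh]) (auto simp: cond_event_def)
  then have "conjunction P A H B K \<omega> = cond_event P A H \<omega>" for \<omega>
    using min_eq[of \<omega>]
    by (cases "\<omega> \<in> H \<union> K") (simp_all add: conjunction_def cond_event_def cond_rq_def)
  then show ?thesis by (rule ext)
qed

end
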